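(* Let $d \geq 1$ and $k \geq 2$ be integers, and let $\varepsilon \in (0,1/\sqrt{d})$. If $F \subseteq \mathbb{R}^d$ is non-empty and $$\dim_{\mathrm{A}} F > d + \frac{\log(1-1/k)}{\log\left(k \lceil \sqrt{d}/(2\varepsilon) \rceil\right)},$$ then $F$ contains a $(k,\varepsilon,\{e\})$-AP for every direction $e \in S^{d-1}$.
   Context: $S^{d-1}$ is the set of unit vectors in $\mathbb{R}^d$. For an integer $k \geq 2$, $\varepsilon \geq 0$ and $e \in S^{d-1}$, a set $F \subseteq \mathbb{R}^d$ contains a $(k,\varepsilon,\{e\})$-AP if there exist $t \in \mathbb{R}^d$ and a gap length $\Delta>0$ such that, with $P = \{ t + \Delta x e : x = 0,1,\dots,k-1\}$, $$\sup_{p \in P} \inf_{y \in F} |p-y| \leq \varepsilon \Delta.$$ For a real number $x \ge 0$, $\lceil x \rceil$ is the smallest integer greater than or equal to $x$. For a non-empty bounded set $E \subset \mathbb{R}^d$ and $r>0$, $N(E,r)$ denotes the smallest number of open sets of diameter at most $r$ required to cover $E$. The Assouad dimension of a non-empty set $F \subseteq \mathbb{R}^d$ is $$\dim_{\mathrm{A}} F = \inf\left\{ s \geq 0 : (\exists C>0)(\forall R>0)(\forall r \in (0,R))(\forall x \in F)\ N(B(x,R)\cap F, r) \leq C \left(\frac{R}{r}\right)^s \right\},$$ where $B(x,R)$ is the closed ball with centre $x$ and radius $R$. *)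

theory Defs
  imports "HOL-Analysis.Analysis"
begin

text \<open>
  The infimum and supremum are taken in the extended reals, so that the infimum over an
  empty \<open>F\<close> is \<open>\<infinity>\<close> and the empty set contains no approximate progression.
\<close>

definition contains_AP :: "nat \<Rightarrow> real \<Rightarrow> 'a::euclidean_space \<Rightarrow> 'a set \<Rightarrow> bool" where
  "contains_AP k \<epsilon> e F \<longleftrightarrow>
    (\<exists>t \<Delta>. \<Delta> > 0 \<and>
      (SUP p \<in> {t + (\<Delta> * real x) *\<^sub>R e | x. x < k}. INF y \<in> F. ereal (norm (p - y)))
        \<le> ereal (\<epsilon> * \<Delta>))"

text \<open>
  Boundedness of the covering sets is explicit because \<^const>\<open>diameter\<close> is real-valued and
  carries no information for unbounded sets. For bounded \<open>E\<close> and \<open>r > 0\<close> a finite cover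
  exists, so the minimum is attained.
\<close>

definition covering_number :: "'a::euclidean_space set \<Rightarrow> real \<Rightarrow> nat" where
  "covering_number E r =
    (LEAST n. \<exists>\<U>. finite \<U> \<and> card \<U> = n \<and>
      (\<forall>U\<in>\<U>. open U \<and> bounded U \<and> diameter U \<le> r) \<and> E \<subseteq> \<Union>\<U>)"

text \<open>
  The set of admissible exponents is bounded below by \<open>0\<close> and contains the dimension of the
  ambient space, so the real-valued infimum is meaningful.
\<close>

definition assouad_dim :: "'a::euclidean_space set \<Rightarrow> real" where
  "assouad_dim F =
    Inf {s. s \<ge> 0 \<and>
      (\<exists>C>0. \<forall>R>0. \<forall>r\<in>{0<..<R}. \<forall>x\<in>F.
        real (covering_number (cball x R \<inter> F) r) \<le> C * (R / r) powr s)}"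

end

theory Submission
  imports Defs
begin

text \<open>
  Suppose that \<open>F\<close> contains no approximate progression in direction \<open>e\<close>, put
  \<open>m = \<lceil>\<surd>d / (2\<epsilon>)\<rceil>\<close> and \<open>N = k m\<close>, and use an orthonormal basis containing \<open>e\<close>. Split a cube
  of side \<open>L\<close> into \<open>N\<^sup>d\<close> cubes of side \<open>L / N\<close>. On every line of subcubes parallel to \<open>e\<close>, the
  positions \<open>j, j + m, \<dots>, j + (k - 1) m\<close> have centres in progression with gap \<open>L / k\<close>, and
  \<open>\<surd>d L / (2 N) \<le> \<epsilon> L / k\<close>, so one of these \<open>k\<close> subcubes misses \<open>F\<close>. Hence at most
  \<open>(1 - 1/k) N\<^sup>d = N\<^sup>s\<close> of the subcubes meet \<open>F\<close>, where \<open>s\<close> is the bound in the theorem; iterating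
  gives at most \<open>(N\<^sup>n)\<^sup>s\<close> cubes of side \<open>L / N\<^sup>n\<close>, so \<open>s\<close> is an admissible exponent.
\<close>

section \<open>Counting occupied cells in one block of the integer grid\<close>

lemma mem_PiE_of_div_eq:
  fixes c j :: "'b \<Rightarrow> int"
  assumes "c \<in> B \<rightarrow>\<^sub>E UNIV" "(\<lambda>b\<in>B. c b div int N) = j" "N > 0"
  shows "c \<in> (\<Pi>\<^sub>E b\<in>B. {j b * int N..<j b * int N + int N})"
proof (rule PiE_I)
  fix b assume "b \<in> B"
  then have "c b = j b * int N + c b mod int N" using assms(2) by auto
  moreover have "0 \<le> c b mod int N" "c b mod int N < int N" using assms(3) by auto
  ultimately show "c b \<in> {j b * int N..<j b * int N + int N}" by auto
qed (use assms(1) in \<open>auto simp: PiE_def extensional_def\<close>)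

text \<open>The block over \<open>j\<close> has \<open>k * m\<close> layers in direction
  \<open>e\<close>. It splits into progressions of \<open>k\<close> cells with step
  \<open>m\<close>, one starting at each cell of the first \<open>m\<close> layers. By
  \<open>gap\<close> each progression contains a cell outside \<open>S\<close>, so at least the
  fraction 1/k of the block is missing from \<open>S\<close>.\<close>

lemma card_fibre_le:
  fixes S :: "('b \<Rightarrow> int) set" and m k :: nat and j :: "'b \<Rightarrow> int"
  assumes B: "finite B" "e \<in> B" and m: "m > 0"
    and gap: "\<And>c. c \<in> B \<rightarrow>\<^sub>E UNIV \<Longrightarrow> \<exists>x<k. c(e := c e + int (m * x)) \<notin> S"
    and S: "S \<subseteq> B \<rightarrow>\<^sub>E UNIV"
  shows "card {c \<in> S. (\<lambda>b\<in>B. c b div int (k * m)) = j} \<le> (k - 1) * m * (k * m) ^ (card B - 1)"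
proof -
  obtain x where x: "\<And>c. c \<in> B \<rightarrow>\<^sub>E UNIV \<Longrightarrow> x c < k \<and> c(e := c e + int (m * x c)) \<notin> S"
    using gap by metis
  have k: "k > 0"
    using gap[of "\<lambda>b\<in>B. 0"] by auto
  define N where "N = k * m"
  have N: "N > 0" using k m by (simp add: N_def)
  define Q where "Q = (\<Pi>\<^sub>E b\<in>B. {j b * int N..<j b * int N + int N})"
  \<comment> \<open>\<open>D\<close> consists of the first \<open>m\<close> layers of the block
    \<open>Q\<close>, the starting cells of the progressions; \<open>\<phi>\<close> sends a starting
    cell to a missing cell of its progression.\<close>
  define D where "D = (\<Pi>\<^sub>E b\<in>B. {j b * int N..<j b * int N + (if b = e then int m else int N)})"
  define \<phi> where "\<phi> c = c(e := c e + int (m * x c))" for c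
  have finQ: "finite Q"
    unfolding Q_def using B by (intro finite_PiE) auto
  have cardQ: "card Q = N * N ^ (card B - 1)"
  proof -
    have "card B = Suc (card B - 1)" using B card_gt_0_iff[of B] by auto
    moreover have "card Q = N ^ card B" unfolding Q_def using B(1) by (simp add: card_PiE)
    ultimately show ?thesis by (metis power_Suc)
  qed
  have "card D = (\<Prod>b\<in>B. if b = e then m else N)"
    unfolding D_def using B by (subst card_PiE) (auto intro!: prod.cong)
  also have "\<dots> = m * N ^ (card B - 1)"
    using B by (subst prod.remove[of _ e]) (auto simp: card_Diff_singleton)
  finally have cardD: "card D = m * N ^ (card B - 1)" .
  have DB: "D \<subseteq> B \<rightarrow>\<^sub>E UNIV"
    by (auto simp: D_def PiE_def)
  have DN: "c e \<in> {j e * int N..<j e * int N + int m}" if "c \<in> D" for c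
    using PiE_mem[OF that[unfolded D_def] B(2)] by simp
  have "inj_on \<phi> D"
  proof (rule inj_onI)
    fix c c' assume c: "c \<in> D" "c' \<in> D" and eq: "\<phi> c = \<phi> c'"
    have "c e + int m * int (x c) = c' e + int m * int (x c')"
      using fun_cong[OF eq, of e] by (simp add: \<phi>_def)
    \<comment> \<open>The offset from the corner of the block lies in [0, m) for cells of
      \<open>D\<close>. Reducing mod \<open>m\<close> removes the shift, whatever \<open>x\<close>
      is, and recovers that offset.\<close>
    then have "(c e - j e * int N + int m * int (x c)) mod int m
        = (c' e - j e * int N + int m * int (x c')) mod int m"
      by (simp add: algebra_simps)
    then have "c e = c' e"
      using DN[OF c(1)] DN[OF c(2)] by simp
    moreover have "c b = c' b" if "b \<noteq> e" for b
      using fun_cong[OF eq, of b] that by (simp add: \<phi>_def)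
    ultimately show "c = c'" by (metis ext)
  qed
  moreover have "\<phi> ` D \<subseteq> Q - S"
  proof (rule image_subsetI)
    fix c assume c: "c \<in> D"
    have xc: "x c < k" "\<phi> c \<notin> S"
      using x[of c] c DB by (auto simp: \<phi>_def)
    have "m * x c + m \<le> N"
    proof -
      have "m * Suc (x c) \<le> m * k" using xc(1) by (intro mult_le_mono) auto
      then show ?thesis by (simp add: N_def algebra_simps)
    qed
    then have "int (m * x c) + int m \<le> int N" "int (m * x c) \<ge> 0" by linarith+
    then have "\<phi> c e \<in> {j e * int N..<j e * int N + int N}"
      using DN[OF c] unfolding \<phi>_def fun_upd_same atLeastLessThan_iff by linarith
    moreover have "c b \<in> {j b * int N..<j b * int N + int N}" if "b \<in> B" "b \<noteq> e" for b
      using PiE_mem[OF c[unfolded D_def] that(1)] that(2) by simp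
    moreover have "\<phi> c b = undefined" if "b \<notin> B" for b
      using c that B(2) by (auto simp: \<phi>_def D_def PiE_def extensional_def)
    ultimately have "\<phi> c \<in> Q"
      unfolding Q_def PiE_iff extensional_def by (auto simp: \<phi>_def)
    then show "\<phi> c \<in> Q - S" using xc by simp
  qed
  ultimately have "card D \<le> card (Q - S)"
    using finQ by (intro card_inj_on_le) auto
  moreover have "card (Q - S) + card (S \<inter> Q) = card Q"
    using finQ by (metis Int_commute add.commute card_Int_Diff)
  ultimately have "card (S \<inter> Q) \<le> N * N ^ (card B - 1) - m * N ^ (card B - 1)"
    using cardD cardQ by simp
  also have "\<dots> = (k - 1) * m * N ^ (card B - 1)"
    by (simp add: N_def algebra_simps diff_mult_distrib)
  finally have "card (S \<inter> Q) \<le> (k - 1) * m * N ^ (card B - 1)" .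
  moreover have "card {c \<in> S. (\<lambda>b\<in>B. c b div int N) = j} \<le> card (S \<inter> Q)"
  proof (rule card_mono)
    show "{c \<in> S. (\<lambda>b\<in>B. c b div int N) = j} \<subseteq> S \<inter> Q"
    proof
      fix c assume "c \<in> {c \<in> S. (\<lambda>b\<in>B. c b div int N) = j}"
      then have "c \<in> S" "(\<lambda>b\<in>B. c b div int N) = j" by simp_all
      then show "c \<in> S \<inter> Q"
        using mem_PiE_of_div_eq[OF subsetD[OF S] _ N] unfolding Q_def by (intro IntI)
    qed
  qed (use finQ in simp)
  ultimately show ?thesis unfolding N_def by linarith
qed

section \<open>Grids of cubes in an orthonormal basis\<close>

locale orthonormal_basis =
  fixes B :: "'a::euclidean_space set"
  assumes orth: "pairwise orthogonal B" and unit: "\<And>b. b \<in> B \<Longrightarrow> norm b = 1"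
    and span: "span B = UNIV" and card_B: "card B = DIM('a)"
begin

lemma finite_B: "finite B"
  using card_B card.infinite by fastforce

lemma inner_B: "b \<in> B \<Longrightarrow> b' \<in> B \<Longrightarrow> b \<bullet> b' = (if b = b' then 1 else 0)"
  using orth unit by (auto simp: pairwise_def orthogonal_def norm_eq_1)

lemma inner_sum_B:
  assumes "b \<in> B"
  shows "(\<Sum>b'\<in>B. f b' *\<^sub>R b') \<bullet> b = f b"
proof -
  have "(\<Sum>b'\<in>B. f b' *\<^sub>R b') \<bullet> b = (\<Sum>b'\<in>B. if b' = b then f b' else 0)"
    using assms by (auto simp: inner_sum_left inner_B intro!: sum.cong)
  then show ?thesis using assms finite_B by simp
qed

lemma norm_le_sqrt_DIM:
  assumes "\<And>b. b \<in> B \<Longrightarrow> \<bar>v \<bullet> b\<bar> \<le> \<rho>"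
  shows "norm v \<le> sqrt DIM('a) * \<rho>"
proof -
  have "B \<noteq> {}" using card_B by fastforce
  then have "\<rho> \<ge> 0" using assms by fastforce
  have "v = (\<Sum>b\<in>B. (v \<bullet> b) *\<^sub>R b)"
    using orthonormal_basis_expand[of B v] orth unit span finite_B by auto
  then have "v \<bullet> v = (\<Sum>b\<in>B. (v \<bullet> b) * (v \<bullet> b))"
    by (metis (no_types, lifting) inner_scaleR_right inner_sum_right sum.cong)
  also have "\<dots> \<le> (\<Sum>b\<in>B. \<rho>\<^sup>2)"
    using assms \<open>\<rho> \<ge> 0\<close>
    by (intro sum_mono) (simp flip: power2_eq_square add: abs_le_square_iff[symmetric])
  finally have "(norm v)\<^sup>2 \<le> (sqrt DIM('a) * \<rho>)\<^sup>2"
    by (simp add: power2_norm_eq_inner power_mult_distrib card_B)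
  then show ?thesis
    using \<open>\<rho> \<ge> 0\<close> power2_le_imp_le by simp
qed

text \<open>Cells are half-open. Grids of all sizes are anchored at the origin, so that they nest.
  The restriction to \<open>B\<close> makes indices extensional, hence equal as functions when they
  agree on \<open>B\<close>, and lets them be counted in \<open>PiE\<close> sets.\<close>

definition cube_index :: "real \<Rightarrow> 'a \<Rightarrow> 'a \<Rightarrow> int" where
  "cube_index \<delta> y = (\<lambda>b\<in>B. \<lfloor>(y \<bullet> b) / \<delta>\<rfloor>)"

definition centre :: "real \<Rightarrow> ('a \<Rightarrow> int) \<Rightarrow> 'a" where
  "centre \<delta> c = (\<Sum>b\<in>B. (\<delta> * (of_int (c b) + 1 / 2)) *\<^sub>R b)"

lemma norm_centre_le:
  assumes "\<delta> > 0"
  shows "norm (centre \<delta> (cube_index \<delta> y) - y) \<le> sqrt DIM('a) * (\<delta> / 2)"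
proof (rule norm_le_sqrt_DIM)
  fix b assume b: "b \<in> B"
  define f where "f = \<lfloor>(y \<bullet> b) / \<delta>\<rfloor>"
  have "of_int f * \<delta> \<le> y \<bullet> b" "y \<bullet> b \<le> (of_int f + 1) * \<delta>"
    using floor_divide_lower[OF assms, of "y \<bullet> b"] floor_divide_upper[OF assms, of "y \<bullet> b"]
    by (simp_all add: f_def)
  moreover have "centre \<delta> (cube_index \<delta> y) \<bullet> b = of_int f * \<delta> + \<delta> / 2"
    using b unfolding centre_def
    by (subst inner_sum_B) (auto simp: cube_index_def f_def algebra_simps)
  ultimately show "\<bar>(centre \<delta> (cube_index \<delta> y) - y) \<bullet> b\<bar> \<le> \<delta> / 2"
    unfolding inner_diff_left distrib_right mult_1 by linarith
qed

lemma centre_fun_upd_add: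
  assumes "e \<in> B"
  shows "centre \<delta> (c(e := c e + n)) = centre \<delta> c + (\<delta> * of_int n) *\<^sub>R e"
  using assms finite_B unfolding centre_def
  by (subst (1 2) sum.remove[of _ e]) (auto simp: algebra_simps intro!: sum.cong)

text \<open>Since the grids share the origin, this is the identity floor(z/N) = floor(z) div N in
  each coordinate.\<close>

lemma cube_index_coarsen:
  assumes "N > 0"
  shows "cube_index \<delta> y = (\<lambda>b\<in>B. cube_index (\<delta> / real N) y b div int N)"
proof -
  have "\<lfloor>(y \<bullet> b) / \<delta>\<rfloor> = \<lfloor>(y \<bullet> b) / (\<delta> / real N)\<rfloor> div int N" for b
    using floor_divide_real_eq_div[of "int N" "(y \<bullet> b) / (\<delta> / real N)"] assms by simp
  then show ?thesis by (auto simp: cube_index_def)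
qed

text \<open>Moving by at most \<open>R\<close> changes each coordinate of the index by at most 1,
  which leaves three values per coordinate.\<close>

lemma card_cube_index_cball_le:
  assumes "R > 0"
  shows "finite (cube_index R ` cball x R)" "card (cube_index R ` cball x R) \<le> 3 ^ DIM('a)"
proof -
  define P where "P = (\<Pi>\<^sub>E b\<in>B. {\<lfloor>(x \<bullet> b) / R\<rfloor> - 1..\<lfloor>(x \<bullet> b) / R\<rfloor> + 1})"
  have sub: "cube_index R ` cball x R \<subseteq> P"
  proof clarify
    fix y assume "y \<in> cball x R"
    then have "norm (y - x) \<le> R" by (simp add: dist_norm norm_minus_commute)
    have "\<lfloor>(y \<bullet> b) / R\<rfloor> \<in> {\<lfloor>(x \<bullet> b) / R\<rfloor> - 1..\<lfloor>(x \<bullet> b) / R\<rfloor> + 1}" if "b \<in> B" for b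
    proof -
      have "\<bar>y \<bullet> b - x \<bullet> b\<bar> \<le> R"
        using Cauchy_Schwarz_ineq2[of "y - x" b] unit[OF that] \<open>norm (y - x) \<le> R\<close>
        by (simp add: inner_diff_left)
      then have "\<bar>(y \<bullet> b) / R - (x \<bullet> b) / R\<bar> \<le> 1"
        using assms by (simp add: field_simps flip: diff_divide_distrib)
      then show ?thesis by (simp add: abs_le_iff) linarith
    qed
    then show "cube_index R y \<in> P" by (auto simp: P_def cube_index_def)
  qed
  have fin: "finite P" unfolding P_def using finite_B by (intro finite_PiE) auto
  show "finite (cube_index R ` cball x R)" using sub fin finite_subset by blast
  have "card P = 3 ^ DIM('a)" unfolding P_def using finite_B card_B by (simp add: card_PiE)
  then show "card (cube_index R ` cball x R) \<le> 3 ^ DIM('a)" using card_mono[OF fin sub] by simp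
qed

lemma covering_number_le_card_cube_index:
  assumes "\<delta> > 0" "2 * sqrt DIM('a) * \<delta> \<le> r" "finite (cube_index \<delta> ` E)"
  shows "covering_number E r \<le> card (cube_index \<delta> ` E)"
proof -
  \<comment> \<open>A cell lies within half its diagonal,
    \<open>sqrt DIM('a) * \<delta> / 2\<close>, of its centre. Doubling this radius makes the
    inequality strict, as the covering sets have to be open.\<close>
  define \<U> where "\<U> = (\<lambda>c. ball (centre \<delta> c) (sqrt DIM('a) * \<delta>)) ` cube_index \<delta> ` E"
  have "y \<in> ball (centre \<delta> (cube_index \<delta> y)) (sqrt DIM('a) * \<delta>)" for y
  proof -
    have "sqrt DIM('a) * (\<delta> / 2) < sqrt DIM('a) * \<delta>" using assms(1) by simp
    then show ?thesis using norm_centre_le[OF assms(1), of y] unfolding mem_ball dist_norm by linarith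
  qed
  then have "E \<subseteq> \<Union>\<U>" by (auto simp: \<U>_def)
  moreover have "diameter U \<le> r" if "U \<in> \<U>" for U
  proof -
    \<comment> \<open>Rules out the negative radius case in the formula for the diameter of a
      ball.\<close>
    have "\<not> sqrt DIM('a) * \<delta> < 0" using assms(1) by (simp add: not_less)
    then show ?thesis using that assms(2) by (auto simp: \<U>_def simp del: mult_less_0_iff)
  qed
  ultimately have "covering_number E r \<le> card \<U>"
    unfolding covering_number_def using assms(3)
    by (intro Least_le exI[of _ \<U>]) (auto simp: \<U>_def)
  also have "\<dots> \<le> card (cube_index \<delta> ` E)"
    unfolding \<U>_def using assms(3) by (rule card_image_le)
  finally show ?thesis .
qed

text \<open>If \<open>F\<close> met all \<open>k\<close> cells, their centres would form a
  progression with gap \<open>m * \<delta>\<close>. Each centre would be within half a diagonal of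
  \<open>F\<close>, and \<open>m\<close> is large enough for this to be at most \<epsilon> times the
  gap.\<close>

lemma ex_cube_disjoint:
  assumes "\<not> contains_AP k \<epsilon> e F" "e \<in> B" "\<delta> > 0" "m > 0"
    and m: "sqrt DIM('a) / 2 \<le> \<epsilon> * real m"
  shows "\<exists>x<k. c(e := c e + int (m * x)) \<notin> cube_index \<delta> ` F"
proof (rule ccontr)
  assume "\<not> ?thesis"
  then have hit: "\<exists>y\<in>F. cube_index \<delta> y = c(e := c e + int (m * x))" if "x < k" for x
    using that by (metis imageE)
  define \<Delta> where "\<Delta> = real m * \<delta>"
  have "(INF y\<in>F. ereal (norm (centre \<delta> c + (\<Delta> * real x) *\<^sub>R e - y))) \<le> ereal (\<epsilon> * \<Delta>)"
    if "x < k" for x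
  proof -
    obtain y where y: "y \<in> F" "cube_index \<delta> y = c(e := c e + int (m * x))"
      using hit[OF \<open>x < k\<close>] by blast
    have "centre \<delta> (cube_index \<delta> y) = centre \<delta> c + (\<Delta> * real x) *\<^sub>R e"
      unfolding y(2) centre_fun_upd_add[OF assms(2)] by (simp add: \<Delta>_def algebra_simps)
    then have "norm (centre \<delta> c + (\<Delta> * real x) *\<^sub>R e - y) \<le> sqrt DIM('a) / 2 * \<delta>"
      using norm_centre_le[OF assms(3), of y] by simp
    also have "\<dots> \<le> \<epsilon> * \<Delta>"
      using mult_right_mono[OF m, of \<delta>] assms(3) by (simp add: \<Delta>_def algebra_simps)
    finally show ?thesis using y(1) by (intro INF_lower2[of y]) auto
  qed
  moreover have "\<Delta> > 0" using assms by (simp add: \<Delta>_def)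
  ultimately have "contains_AP k \<epsilon> e F"
    unfolding contains_AP_def
    by (intro exI[of _ "centre \<delta> c"] exI[of _ \<Delta>]) (auto intro!: SUP_least)
  with assms(1) show False by contradiction
qed

text \<open>Each refinement replaces an occupied cell by at most
  \<open>(k - 1) * m * (k * m) ^ (DIM('a) - 1)\<close> occupied subcells; the factor
  \<open>3 ^ DIM('a)\<close> counts the cells of side \<open>R\<close> at the start. Finiteness is
  carried along because \<open>card\<close> is 0 on infinite sets.\<close>

lemma card_cube_index_refine_le:
  assumes noAP: "\<not> contains_AP k \<epsilon> e F" "e \<in> B" "R > 0" "m > 0"
    and m: "sqrt DIM('a) / 2 \<le> \<epsilon> * real m"
    and "k > 0"
  shows "finite (cube_index (R / real (k * m) ^ n) ` (cball x R \<inter> F)) \<and>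
    card (cube_index (R / real (k * m) ^ n) ` (cball x R \<inter> F))
      \<le> 3 ^ DIM('a) * ((k - 1) * m * (k * m) ^ (DIM('a) - 1)) ^ n"
proof (induction n)
  case 0
  have "cube_index R ` (cball x R \<inter> F) \<subseteq> cube_index R ` cball x R" by auto
  then show ?case
    using card_cube_index_cball_le[OF assms(3), of x]
      finite_subset[of "cube_index R ` (cball x R \<inter> F)" "cube_index R ` cball x R"]
      card_mono[of "cube_index R ` cball x R" "cube_index R ` (cball x R \<inter> F)"]
    by simp
next
  case (Suc n)
  define N where "N = k * m"
  define M where "M = (k - 1) * m * N ^ (DIM('a) - 1)"
  define \<delta> where "\<delta> = R / real N ^ n"
  have "N > 0" using assms by (simp add: N_def)
  then have "\<delta> > 0" using assms by (simp add: \<delta>_def)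
  define A where "A \<eta> = cube_index \<eta> ` (cball x R \<inter> F)" for \<eta>
  \<comment> \<open>\<open>H j\<close> is the set of occupied subcells of the cell \<open>j\<close>,
    a fibre of the coarsening map.\<close>
  define H where "H j = {c \<in> A (\<delta> / real N). (\<lambda>b\<in>B. c b div int N) = j}" for j
  have IH: "finite (A \<delta>)" "card (A \<delta>) \<le> 3 ^ DIM('a) * M ^ n"
    using Suc by (auto simp: A_def \<delta>_def M_def N_def)
  have A_sub: "A (\<delta> / real N) \<subseteq> B \<rightarrow>\<^sub>E UNIV"
    by (auto simp: A_def cube_index_def)
  have cardH: "card (H j) \<le> M" for j
    unfolding H_def M_def N_def card_B[symmetric]
  proof (rule card_fibre_le[OF finite_B assms(2,4)])
    fix c
    \<comment> \<open>A cell that misses \<open>F\<close> also misses the part of \<open>F\<close>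
      in the ball, so the gap property passes to \<open>A\<close>.\<close>
    have "A (\<delta> / real (k * m)) \<subseteq> cube_index (\<delta> / real (k * m)) ` F" by (auto simp: A_def)
    then show "\<exists>x<k. c(e := c e + int (m * x)) \<notin> A (\<delta> / real (k * m))"
      using ex_cube_disjoint[OF noAP(1,2) _ assms(4) m, of "\<delta> / real (k * m)" c]
        \<open>\<delta> > 0\<close> \<open>N > 0\<close> unfolding N_def by (meson divide_pos_pos of_nat_0_less_iff subsetD)
  qed (use A_sub in \<open>auto simp: N_def\<close>)
  have union: "A (\<delta> / real N) = (\<Union>j\<in>A \<delta>. H j)"
    using cube_index_coarsen[OF \<open>N > 0\<close>, of \<delta>] by (auto simp: A_def H_def)
  have "finite (H j)" for j
  proof -
    have "H j \<subseteq> (\<Pi>\<^sub>E b\<in>B. {j b * int N..<j b * int N + int N})"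
    proof
      fix c assume "c \<in> H j"
      then have "c \<in> A (\<delta> / real N)" "(\<lambda>b\<in>B. c b div int N) = j" by (simp_all add: H_def)
      then show "c \<in> (\<Pi>\<^sub>E b\<in>B. {j b * int N..<j b * int N + int N})"
        using mem_PiE_of_div_eq[OF subsetD[OF A_sub] _ \<open>N > 0\<close>] by simp
    qed
    then show ?thesis
      using finite_B by (meson finite_PiE finite_atLeastLessThan_int finite_subset)
  qed
  then have fin: "finite (A (\<delta> / real N))" using IH(1) by (simp add: union)
  have "card (A (\<delta> / real N)) \<le> (\<Sum>j\<in>A \<delta>. card (H j))"
    unfolding union using IH(1) by (rule card_UN_le)
  also have "\<dots> \<le> card (A \<delta>) * M"
    using sum_bounded_above[of "A \<delta>" "\<lambda>j. card (H j)" M] cardH by simp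
  also have "\<dots> \<le> 3 ^ DIM('a) * M ^ n * M" using IH(2) by (rule mult_le_mono1)
  finally have "card (A (\<delta> / real N)) \<le> 3 ^ DIM('a) * M ^ Suc n" by (simp add: mult_ac)
  moreover have "\<delta> / real N = R / real N ^ Suc n" by (simp add: \<delta>_def)
  ultimately show ?case using fin by (simp only: A_def M_def N_def)
qed

end

section \<open>From cell counts to the Assouad dimension\<close>

lemma assouad_dim_le:
  assumes "s \<ge> 0" "C > 0"
    and "\<And>R r x. 0 < r \<Longrightarrow> r < R \<Longrightarrow> x \<in> F \<Longrightarrow>
      real (covering_number (cball x R \<inter> F) r) \<le> C * (R / r) powr s"
  shows "assouad_dim F \<le> s"
  unfolding assouad_dim_def using assms by (intro cInf_lower bdd_belowI[of _ 0]) auto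

text \<open>Rounds an arbitrary ratio of scales up to a power of \<open>b\<close>, at the cost of a
  factor at most \<open>b\<close>; the exponent is the ceiling of \<open>log b t\<close>.\<close>

lemma ex_power_between:
  fixes b t :: real
  assumes "b > 1" "t \<ge> 1"
  shows "\<exists>n. t \<le> b ^ n \<and> b ^ n \<le> b * t"
proof -
  define n where "n = nat \<lceil>log b t\<rceil>"
  have "log b t \<ge> 0" using assms by simp
  then have n: "log b t \<le> real n" "real n \<le> log b t + 1" unfolding n_def by linarith+
  have "t = b powr log b t" "b * t = b powr (log b t + 1)"
    using assms by (auto simp: powr_add)
  moreover have "b ^ n = b powr real n" using assms by (simp add: powr_realpow)
  moreover have "b powr log b t \<le> b powr real n" "b powr real n \<le> b powr (log b t + 1)"
    using n assms by (simp_all only: powr_mono less_imp_le)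
  ultimately have "t \<le> b ^ n" "b ^ n \<le> b * t" by simp_all
  then show ?thesis by blast
qed

theorem assouad_dim_le_of_no_AP:
  fixes F :: "'a::euclidean_space set"
  assumes k: "k \<ge> 2" and m: "m > 0" "sqrt DIM('a) / 2 \<le> \<epsilon> * real m"
    and e: "norm e = 1" and noAP: "\<not> contains_AP k \<epsilon> e F"
  shows "assouad_dim F \<le> DIM('a) + ln (1 - 1 / real k) / ln (real (k * m))"
proof -
  obtain B where B: "e \<in> B" "pairwise orthogonal B" "\<And>b. b \<in> B \<Longrightarrow> norm b = 1"
    "card B = DIM('a)" "span B = UNIV"
    using vector_in_orthonormal_basis[OF e] by metis
  interpret orthonormal_basis B by unfold_locales (use B in auto)
  define d where "d = DIM('a)"
  define N where "N = k * m"
  define M where "M = (k - 1) * m * N ^ (d - 1)"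
  define s where "s = real d + ln (1 - 1 / real k) / ln (real N)"
  have "d > 0" by (simp add: d_def)
  have "N \<ge> 2" using mult_le_mono[of 2 k 1 m] k m by (simp add: N_def)
  have k1: "1 - 1 / real k > 0" using k by simp
  \<comment> \<open>The exponent \<open>s\<close> is chosen so that refining by \<open>N\<close>
    multiplies the bound on the number of occupied cells by exactly \<open>N powr s\<close>.\<close>
  have "N powr s = real N ^ d * (1 - 1 / real k)"
  proof -
    have "N powr (ln (1 - 1 / real k) / ln (real N)) = 1 - 1 / real k"
      using k1 \<open>N \<ge> 2\<close> by (simp add: powr_def)
    then show ?thesis using \<open>N \<ge> 2\<close> by (simp add: s_def powr_add powr_realpow)
  qed
  also have "real N ^ d = real N * real N ^ (d - 1)"
    using \<open>d > 0\<close> by (metis Suc_pred' power_Suc)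
  also have "\<dots> * (1 - 1 / real k) = real M"
    using k by (simp add: M_def N_def of_nat_diff field_simps)
  finally have M: "real M = N powr s" by simp
  \<comment> \<open>Only nonnegative exponents are admissible. Here \<open>k \<ge> 2\<close> gives
    \<open>M \<ge> 1\<close>, and a negative \<open>s\<close> would make \<open>N powr s\<close>
    less than 1.\<close>
  have "M \<ge> 1" using k m \<open>N \<ge> 2\<close> by (simp add: M_def Suc_le_eq)
  then have "s \<ge> 0"
    using M \<open>N \<ge> 2\<close> powr_less_one[of "real N" s] by (cases "s < 0") auto
  \<comment> \<open>\<open>3 ^ d\<close> counts the initial cells, \<open>N\<close> pays for
    rounding to a power of \<open>N\<close>, and \<open>2 * sqrt d\<close> is the ratio of the
    diameter of a covering ball to the side of its cell.\<close>
  define C where "C = 3 ^ d * (real N * (2 * sqrt d)) powr s"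
  have "C > 0" using \<open>N \<ge> 2\<close> \<open>d > 0\<close> by (simp add: C_def)
  have "assouad_dim F \<le> s"
  proof (rule assouad_dim_le[OF \<open>s \<ge> 0\<close> \<open>C > 0\<close>])
    fix R r :: real and x assume r: "0 < r" "r < R"
    \<comment> \<open>For \<open>\<delta> = R / N ^ n\<close>, the condition
      \<open>t \<le> N ^ n\<close> says precisely that the covering balls have diameter
      \<open>2 * sqrt d * \<delta> \<le> r\<close>.\<close>
    define t where "t = 2 * sqrt d * (R / r)"
    have "sqrt d \<ge> 1" using \<open>d > 0\<close> by simp
    then have "2 * sqrt d \<ge> 1" by linarith
    then have "1 * 1 \<le> t" unfolding t_def using r by (intro mult_mono) (auto simp: field_simps)
    then obtain n where n: "t \<le> real N ^ n" "real N ^ n \<le> real N * t"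
      using ex_power_between[of "real N" t] \<open>N \<ge> 2\<close> by auto
    define \<delta> where "\<delta> = R / real N ^ n"
    have "\<delta> > 0" using r \<open>N \<ge> 2\<close> by (simp add: \<delta>_def)
    have "2 * sqrt d * \<delta> \<le> r"
      using n(1) r \<open>N \<ge> 2\<close> by (simp add: \<delta>_def t_def field_simps)
    have cubes: "finite (cube_index \<delta> ` (cball x R \<inter> F))"
      "card (cube_index \<delta> ` (cball x R \<inter> F)) \<le> 3 ^ d * M ^ n"
      using card_cube_index_refine_le[OF noAP B(1) _ m, of R n x] r k
      by (auto simp: \<delta>_def N_def M_def d_def)
    have "covering_number (cball x R \<inter> F) r \<le> 3 ^ d * M ^ n"
      using covering_number_le_card_cube_index[OF \<open>\<delta> > 0\<close> _ cubes(1), of r]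
        \<open>2 * sqrt d * \<delta> \<le> r\<close> cubes(2) by (simp add: d_def)
    then have "real (covering_number (cball x R \<inter> F) r) \<le> real (3 ^ d * M ^ n)"
      by (rule of_nat_mono)
    also have "\<dots> = 3 ^ d * (real N ^ n) powr s"
      using \<open>N \<ge> 2\<close> by (simp add: M powr_powr powr_realpow[symmetric] powr_power mult.commute)
    also have "\<dots> \<le> 3 ^ d * (real N * t) powr s"
      using n(2) \<open>s \<ge> 0\<close> by (intro mult_left_mono powr_mono2) auto
    also have "\<dots> = C * (R / r) powr s"
      using r by (simp add: C_def t_def mult.assoc flip: powr_mult)
    finally show "real (covering_number (cball x R \<inter> F) r) \<le> C * (R / r) powr s" .
  qed
  then show ?thesis by (simp add: s_def d_def N_def)
qed

theorem corollary5p2: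
  fixes F :: "(real ^ 'd) set" and k :: nat and \<epsilon> :: real
  assumes "k \<ge> 2"
    and "\<epsilon> \<in> {0 <..< 1 / sqrt (real CARD('d))}"
    and "F \<noteq> {}"
    and "assouad_dim F >
      real CARD('d) +
        ln (1 - 1 / real k) / ln (real k * real_of_int \<lceil>sqrt (real CARD('d)) / (2 * \<epsilon>)\<rceil>)"
  shows "\<forall>e \<in> sphere 0 1. contains_AP k \<epsilon> e F"
proof (rule ballI, rule ccontr)
  fix e :: "real ^ 'd" assume e: "e \<in> sphere 0 1" and noAP: "\<not> contains_AP k \<epsilon> e F"
  define q where "q = sqrt (real CARD('d)) / (2 * \<epsilon>)"
  \<comment> \<open>As \<open>q\<close> is positive, so is its ceiling, and \<open>nat\<close> does
    not truncate it.\<close>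
  define m where "m = nat \<lceil>q\<rceil>"
  have "\<epsilon> > 0" using assms(2) by simp
  then have "q > 0" by (simp add: q_def)
  then have m: "m > 0" "real m = real_of_int \<lceil>q\<rceil>" "q \<le> real m" by (auto simp: m_def)
  have "sqrt DIM(real ^ 'd) / 2 \<le> \<epsilon> * real m"
    using m(3) \<open>\<epsilon> > 0\<close> by (simp add: q_def field_simps)
  from assouad_dim_le_of_no_AP[OF assms(1) m(1) this _ noAP] show False
    using e assms(4) by (simp add: m(2) q_def)
qed

end
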